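(* The category $\mathbf{MIA}$ of monadic implication algebras and their homomorphisms is isomorphic to the category $\mathbf{MBA}$ of monadic Boolean algebras and their homomorphisms.
   Context: An implication algebra is a set $A$ with a binary operation $\cdot$ satisfying, for all $x,y,z\in A$: $(x\cdot y)\cdot x=x$; $(x\cdot y)\cdot y=(y\cdot x)\cdot x$; $x\cdot(y\cdot z)=y\cdot(x\cdot z)$. In any implication algebra the element $x\cdot x$ does not depend on $x$; it is denoted $c_1$. A bounded implication algebra is an implication algebra with a constant $c_0$ satisfying $c_0\cdot x=c_1$ for all $x$. A monadic implication algebra is a bounded implication algebra $A$ with an operator $\nabla\colon A\to A$ such that for all $x,y\in A$: (1) $\nabla c_0=c_0$ and $x\cdot\nabla x=c_1$; (2) $\nabla((x\cdot(\nabla y\cdot c_0))\cdot c_0)=(\nabla x\cdot(\nabla y\cdot c_0))\cdot c_0$. A homomorphism of monadic implication algebras is a function $h$ with $h(x\cdot y)=h(x)\cdot h(y)$, $h(c_0)=c_0$ and $h(\nabla x)=\nabla h(x)$. A monadic Boolean algebra is a Boolean algebra $\langle A;\wedge,\vee,{}',0,1\rangle$ with a unary operator $\exists\colon A\to A$ such that for all $x,y$: (a) $\exists 0=0$ and $x\leq\exists x$; (b) $\exists(x\wedge\exists y)=\exists x\wedge\exists y$. Homomorphisms of monadic Boolean algebras are Boolean algebra homomorphisms $h$ with $h(\exists x)=\exists h(x)$. Two categories are isomorphic if there are functors between them, in opposite directions, whose composites are the respective identity functors. *)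

theory Defs
  imports "HOL-Algebra.Congruence"
begin

section \<open>Categories, functors and isomorphism of categories\<close>

record ('o, 'm) category =
  Obj :: "'o set"
  Arr :: "'m set"
  Dom :: "'m \<Rightarrow> 'o"
  Cod :: "'m \<Rightarrow> 'o"
  Id :: "'o \<Rightarrow> 'm"
  Comp :: "'m \<Rightarrow> 'm \<Rightarrow> 'm"

text \<open>Composition is in applicative order: \<open>Comp C g f\<close> is \<open>g\<close> after \<open>f\<close>. The values of the
  operations outside the stated domains are irrelevant.\<close>

locale category =
  fixes C :: "('o, 'm) category"
  assumes Dom_Obj: "f \<in> Arr C \<Longrightarrow> Dom C f \<in> Obj C"
    and Cod_Obj: "f \<in> Arr C \<Longrightarrow> Cod C f \<in> Obj C"
    and Id_Arr: "X \<in> Obj C \<Longrightarrow> Id C X \<in> Arr C"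
    and Dom_Id: "X \<in> Obj C \<Longrightarrow> Dom C (Id C X) = X"
    and Cod_Id: "X \<in> Obj C \<Longrightarrow> Cod C (Id C X) = X"
    and Comp_Arr: "\<lbrakk>f \<in> Arr C; g \<in> Arr C; Cod C f = Dom C g\<rbrakk> \<Longrightarrow> Comp C g f \<in> Arr C"
    and Dom_Comp: "\<lbrakk>f \<in> Arr C; g \<in> Arr C; Cod C f = Dom C g\<rbrakk> \<Longrightarrow> Dom C (Comp C g f) = Dom C f"
    and Cod_Comp: "\<lbrakk>f \<in> Arr C; g \<in> Arr C; Cod C f = Dom C g\<rbrakk> \<Longrightarrow> Cod C (Comp C g f) = Cod C g"
    and Comp_Id_right: "f \<in> Arr C \<Longrightarrow> Comp C f (Id C (Dom C f)) = f"
    and Comp_Id_left: "f \<in> Arr C \<Longrightarrow> Comp C (Id C (Cod C f)) f = f"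
    and Comp_assoc: "\<lbrakk>f \<in> Arr C; g \<in> Arr C; h \<in> Arr C; Cod C f = Dom C g; Cod C g = Dom C h\<rbrakk>
      \<Longrightarrow> Comp C h (Comp C g f) = Comp C (Comp C h g) f"

record ('o1, 'm1, 'o2, 'm2) functor_maps =
  on_obj :: "'o1 \<Rightarrow> 'o2"
  on_arr :: "'m1 \<Rightarrow> 'm2"

locale category_functor = C: category C + D: category D
  for C :: "('o1, 'm1) category" and D :: "('o2, 'm2) category" +
  fixes F :: "('o1, 'm1, 'o2, 'm2) functor_maps"
  assumes on_obj_Obj: "X \<in> Obj C \<Longrightarrow> on_obj F X \<in> Obj D"
    and on_arr_Arr: "f \<in> Arr C \<Longrightarrow> on_arr F f \<in> Arr D"
    and Dom_on_arr: "f \<in> Arr C \<Longrightarrow> Dom D (on_arr F f) = on_obj F (Dom C f)"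
    and Cod_on_arr: "f \<in> Arr C \<Longrightarrow> Cod D (on_arr F f) = on_obj F (Cod C f)"
    and on_arr_Id: "X \<in> Obj C \<Longrightarrow> on_arr F (Id C X) = Id D (on_obj F X)"
    and on_arr_Comp: "\<lbrakk>f \<in> Arr C; g \<in> Arr C; Cod C f = Dom C g\<rbrakk>
      \<Longrightarrow> on_arr F (Comp C g f) = Comp D (on_arr F g) (on_arr F f)"

text \<open>The two composites are compared with the identity functors on the objects and arrows of
  the categories, not on the whole underlying types.\<close>

definition isomorphic_categories ::
    "('o1, 'm1) category \<Rightarrow> ('o2, 'm2) category \<Rightarrow> bool" where
  "isomorphic_categories C D \<longleftrightarrow> category C \<and> category D \<and>
    (\<exists>F G. category_functor C D F \<and> category_functor D C G \<and>
      (\<forall>X \<in> Obj C. on_obj G (on_obj F X) = X) \<and>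
      (\<forall>f \<in> Arr C. on_arr G (on_arr F f) = f) \<and>
      (\<forall>Y \<in> Obj D. on_obj F (on_obj G Y) = Y) \<and>
      (\<forall>g \<in> Arr D. on_arr F (on_arr G g) = g))"

text \<open>The category with a given class of structures as objects and given sets of structure
  preserving maps as morphisms. A morphism is a triple (source, map, target), the map being
  made \<open>undefined\<close> outside the source carrier, so that equal morphisms are equal in HOL.\<close>

definition structure_category ::
    "('a, 'b) partial_object_scheme set \<Rightarrow>
     (('a, 'b) partial_object_scheme \<Rightarrow> ('a, 'b) partial_object_scheme \<Rightarrow> ('a \<Rightarrow> 'a) set) \<Rightarrow>
     (('a, 'b) partial_object_scheme,
      ('a, 'b) partial_object_scheme \<times> ('a \<Rightarrow> 'a) \<times> ('a, 'b) partial_object_scheme) category" where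
  "structure_category Ob Hom =
    \<lparr>Obj = Ob,
     Arr = {(A, h, B). A \<in> Ob \<and> B \<in> Ob \<and> h \<in> Hom A B \<inter> extensional (carrier A)},
     Dom = (\<lambda>(A, h, B). A),
     Cod = (\<lambda>(A, h, B). B),
     Id = (\<lambda>A. (A, \<lambda>x \<in> carrier A. x, A)),
     Comp = (\<lambda>(B', g, C) (A, f, B). (A, compose (carrier A) g f, C))\<rparr>"


section \<open>Monadic implication algebras\<close>

record 'a imp_algebra = "'a partial_object" +
  imp :: "'a \<Rightarrow> 'a \<Rightarrow> 'a" (infixl \<open>\<cdot>\<index>\<close> 70)

record 'a bounded_imp_algebra = "'a imp_algebra" +
  c0 :: 'a (\<open>c\<^sub>0\<index>\<close>)

record 'a monadic_imp_algebra = "'a bounded_imp_algebra" +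
  nabla :: "'a \<Rightarrow> 'a" (\<open>\<nabla>\<index> _\<close> [81] 80)

locale imp_algebra =
  fixes A :: "('a, 'b) imp_algebra_scheme" (structure)
  assumes imp_closed: "\<lbrakk>x \<in> carrier A; y \<in> carrier A\<rbrakk> \<Longrightarrow> x \<cdot> y \<in> carrier A"
    and imp_contract: "\<lbrakk>x \<in> carrier A; y \<in> carrier A\<rbrakk> \<Longrightarrow> (x \<cdot> y) \<cdot> x = x"
    and imp_quasi_comm: "\<lbrakk>x \<in> carrier A; y \<in> carrier A\<rbrakk> \<Longrightarrow> (x \<cdot> y) \<cdot> y = (y \<cdot> x) \<cdot> x"
    and imp_exchange: "\<lbrakk>x \<in> carrier A; y \<in> carrier A; z \<in> carrier A\<rbrakk>
      \<Longrightarrow> x \<cdot> (y \<cdot> z) = y \<cdot> (x \<cdot> z)"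

lemma (in imp_algebra) imp_self_eq:
  assumes x: "x \<in> carrier A" and y: "y \<in> carrier A"
  shows "x \<cdot> x = y \<cdot> y"
proof -
  have step: "(b \<cdot> (a \<cdot> a)) \<cdot> (a \<cdot> a) = a \<cdot> a" if a: "a \<in> carrier A" and b: "b \<in> carrier A" for a b
  proof -
    have "a \<cdot> a = a \<cdot> ((a \<cdot> (b \<cdot> a)) \<cdot> a)"
      using imp_contract[OF a imp_closed[OF b a]] by simp
    also have "\<dots> = (a \<cdot> (b \<cdot> a)) \<cdot> (a \<cdot> a)"
      using a b by (intro imp_exchange imp_closed)
    also have "a \<cdot> (b \<cdot> a) = b \<cdot> (a \<cdot> a)"
      using a b by (intro imp_exchange)
    finally show ?thesis ..
  qed
  have "x \<cdot> x = ((y \<cdot> y) \<cdot> (x \<cdot> x)) \<cdot> (x \<cdot> x)"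
    using step[OF x imp_closed[OF y y]] ..
  also have "\<dots> = ((x \<cdot> x) \<cdot> (y \<cdot> y)) \<cdot> (y \<cdot> y)"
    using x y by (intro imp_quasi_comm imp_closed)
  also have "\<dots> = y \<cdot> y"
    using step[OF y imp_closed[OF x x]] .
  finally show ?thesis .
qed

text \<open>By the preceding lemma this is well defined on every nonempty implication algebra.\<close>

definition c1 :: "('a, 'b) imp_algebra_scheme \<Rightarrow> 'a" (\<open>c\<^sub>1\<index>\<close>) where
  "c\<^sub>1\<^bsub>A\<^esub> = (THE c. \<forall>x \<in> carrier A. x \<cdot>\<^bsub>A\<^esub> x = c)"

locale bounded_imp_algebra = imp_algebra A
  for A :: "('a, 'b) bounded_imp_algebra_scheme" (structure) +
  assumes c0_closed: "c\<^sub>0 \<in> carrier A"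
    and c0_imp: "x \<in> carrier A \<Longrightarrow> c\<^sub>0 \<cdot> x = c\<^sub>1"

locale monadic_imp_algebra = bounded_imp_algebra A
  for A :: "('a, 'b) monadic_imp_algebra_scheme" (structure) +
  assumes nabla_closed: "x \<in> carrier A \<Longrightarrow> \<nabla> x \<in> carrier A"
    and nabla_c0: "\<nabla> c\<^sub>0 = c\<^sub>0"
    and imp_nabla: "x \<in> carrier A \<Longrightarrow> x \<cdot> \<nabla> x = c\<^sub>1"
    and nabla_imp: "\<lbrakk>x \<in> carrier A; y \<in> carrier A\<rbrakk>
      \<Longrightarrow> \<nabla> ((x \<cdot> (\<nabla> y \<cdot> c\<^sub>0)) \<cdot> c\<^sub>0) = (\<nabla> x \<cdot> (\<nabla> y \<cdot> c\<^sub>0)) \<cdot> c\<^sub>0"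

definition mia_hom ::
    "('a, 'c) monadic_imp_algebra_scheme \<Rightarrow> ('b, 'd) monadic_imp_algebra_scheme \<Rightarrow> ('a \<Rightarrow> 'b) set" where
  "mia_hom A B = {h \<in> carrier A \<rightarrow> carrier B.
    (\<forall>x \<in> carrier A. \<forall>y \<in> carrier A. h (x \<cdot>\<^bsub>A\<^esub> y) = h x \<cdot>\<^bsub>B\<^esub> h y) \<and>
    h c\<^sub>0\<^bsub>A\<^esub> = c\<^sub>0\<^bsub>B\<^esub> \<and>
    (\<forall>x \<in> carrier A. h (\<nabla>\<^bsub>A\<^esub> x) = \<nabla>\<^bsub>B\<^esub> (h x))}"


section \<open>Monadic Boolean algebras\<close>

record 'a bool_algebra = "'a partial_object" +
  meet :: "'a \<Rightarrow> 'a \<Rightarrow> 'a" (infixl \<open>\<sqinter>\<index>\<close> 70)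
  join :: "'a \<Rightarrow> 'a \<Rightarrow> 'a" (infixl \<open>\<squnion>\<index>\<close> 65)
  compl :: "'a \<Rightarrow> 'a"
  zero :: 'a (\<open>\<zero>\<index>\<close>)
  one :: 'a (\<open>\<one>\<index>\<close>)

record 'a monadic_bool_algebra = "'a bool_algebra" +
  ex :: "'a \<Rightarrow> 'a"

definition bool_le :: "('a, 'b) bool_algebra_scheme \<Rightarrow> 'a \<Rightarrow> 'a \<Rightarrow> bool" (infix \<open>\<sqsubseteq>\<index>\<close> 50) where
  "x \<sqsubseteq>\<^bsub>A\<^esub> y \<longleftrightarrow> x \<sqinter>\<^bsub>A\<^esub> y = x"

text \<open>A Boolean algebra is a complemented bounded distributive lattice; \<open>\<zero> = \<one>\<close> is allowed.\<close>

locale bool_algebra =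
  fixes A :: "('a, 'b) bool_algebra_scheme" (structure)
  assumes meet_closed: "\<lbrakk>x \<in> carrier A; y \<in> carrier A\<rbrakk> \<Longrightarrow> x \<sqinter> y \<in> carrier A"
    and join_closed: "\<lbrakk>x \<in> carrier A; y \<in> carrier A\<rbrakk> \<Longrightarrow> x \<squnion> y \<in> carrier A"
    and compl_closed: "x \<in> carrier A \<Longrightarrow> compl A x \<in> carrier A"
    and zero_closed: "\<zero> \<in> carrier A"
    and one_closed: "\<one> \<in> carrier A"
    and meet_assoc: "\<lbrakk>x \<in> carrier A; y \<in> carrier A; z \<in> carrier A\<rbrakk>
      \<Longrightarrow> (x \<sqinter> y) \<sqinter> z = x \<sqinter> (y \<sqinter> z)"
    and join_assoc: "\<lbrakk>x \<in> carrier A; y \<in> carrier A; z \<in> carrier A\<rbrakk>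
      \<Longrightarrow> (x \<squnion> y) \<squnion> z = x \<squnion> (y \<squnion> z)"
    and meet_comm: "\<lbrakk>x \<in> carrier A; y \<in> carrier A\<rbrakk> \<Longrightarrow> x \<sqinter> y = y \<sqinter> x"
    and join_comm: "\<lbrakk>x \<in> carrier A; y \<in> carrier A\<rbrakk> \<Longrightarrow> x \<squnion> y = y \<squnion> x"
    and meet_join_absorb: "\<lbrakk>x \<in> carrier A; y \<in> carrier A\<rbrakk> \<Longrightarrow> x \<sqinter> (x \<squnion> y) = x"
    and join_meet_absorb: "\<lbrakk>x \<in> carrier A; y \<in> carrier A\<rbrakk> \<Longrightarrow> x \<squnion> (x \<sqinter> y) = x"
    and meet_join_distrib: "\<lbrakk>x \<in> carrier A; y \<in> carrier A; z \<in> carrier A\<rbrakk>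
      \<Longrightarrow> x \<sqinter> (y \<squnion> z) = (x \<sqinter> y) \<squnion> (x \<sqinter> z)"
    and join_zero: "x \<in> carrier A \<Longrightarrow> x \<squnion> \<zero> = x"
    and meet_one: "x \<in> carrier A \<Longrightarrow> x \<sqinter> \<one> = x"
    and meet_compl: "x \<in> carrier A \<Longrightarrow> x \<sqinter> compl A x = \<zero>"
    and join_compl: "x \<in> carrier A \<Longrightarrow> x \<squnion> compl A x = \<one>"

locale monadic_bool_algebra = bool_algebra A
  for A :: "('a, 'b) monadic_bool_algebra_scheme" (structure) +
  assumes ex_closed: "x \<in> carrier A \<Longrightarrow> ex A x \<in> carrier A"
    and ex_zero: "ex A \<zero> = \<zero>"
    and le_ex: "x \<in> carrier A \<Longrightarrow> x \<sqsubseteq> ex A x"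
    and ex_meet_ex: "\<lbrakk>x \<in> carrier A; y \<in> carrier A\<rbrakk>
      \<Longrightarrow> ex A (x \<sqinter> ex A y) = ex A x \<sqinter> ex A y"

definition bool_hom ::
    "('a, 'c) bool_algebra_scheme \<Rightarrow> ('b, 'd) bool_algebra_scheme \<Rightarrow> ('a \<Rightarrow> 'b) set" where
  "bool_hom A B = {h \<in> carrier A \<rightarrow> carrier B.
    (\<forall>x \<in> carrier A. \<forall>y \<in> carrier A. h (x \<sqinter>\<^bsub>A\<^esub> y) = h x \<sqinter>\<^bsub>B\<^esub> h y) \<and>
    (\<forall>x \<in> carrier A. \<forall>y \<in> carrier A. h (x \<squnion>\<^bsub>A\<^esub> y) = h x \<squnion>\<^bsub>B\<^esub> h y) \<and>
    (\<forall>x \<in> carrier A. h (compl A x) = compl B (h x)) \<and>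
    h \<zero>\<^bsub>A\<^esub> = \<zero>\<^bsub>B\<^esub> \<and> h \<one>\<^bsub>A\<^esub> = \<one>\<^bsub>B\<^esub>}"

definition mba_hom ::
    "('a, 'c) monadic_bool_algebra_scheme \<Rightarrow> ('b, 'd) monadic_bool_algebra_scheme \<Rightarrow> ('a \<Rightarrow> 'b) set" where
  "mba_hom A B = {h \<in> bool_hom A B. \<forall>x \<in> carrier A. h (ex A x) = ex B (h x)}"


section \<open>The two categories\<close>

text \<open>The underlying sets are the subsets of an arbitrary type \<open>'a\<close>, which plays the role of the
  universe. The operations of an object are required to be \<open>undefined\<close> outside the carrier, so
  that records denoting the same algebra are equal.\<close>

definition MIA :: "('a monadic_imp_algebra,
    'a monadic_imp_algebra \<times> ('a \<Rightarrow> 'a) \<times> 'a monadic_imp_algebra) category" where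
  "MIA = structure_category
    {A. monadic_imp_algebra A \<and>
        case_prod (imp A) \<in> extensional (carrier A \<times> carrier A) \<and>
        nabla A \<in> extensional (carrier A)}
    mia_hom"

definition MBA :: "('a monadic_bool_algebra,
    'a monadic_bool_algebra \<times> ('a \<Rightarrow> 'a) \<times> 'a monadic_bool_algebra) category" where
  "MBA = structure_category
    {A. monadic_bool_algebra A \<and>
        case_prod (meet A) \<in> extensional (carrier A \<times> carrier A) \<and>
        case_prod (join A) \<in> extensional (carrier A \<times> carrier A) \<and>
        compl A \<in> extensional (carrier A) \<and>
        ex A \<in> extensional (carrier A)}
    mba_hom"

end

theory Submission
  imports Defs
begin

text \<open>A bounded implication algebra is a Boolean algebra in disguise: with \<open>x' = x \<cdot> c\<^sub>0\<close> the
  relation \<open>x \<cdot> y = c\<^sub>1\<close> is a partial order in which \<open>(x \<cdot> y) \<cdot> y\<close> is the join of \<open>x\<close> and \<open>y\<close>,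
  and \<open>x \<cdot> y\<close> is the join of \<open>x'\<close> and \<open>y\<close>. The complement is an order-reversing involution, so
  \<open>(x \<cdot> y') \<cdot> c\<^sub>0\<close> is the meet, and exchange turns into the residuation law
  \<open>x \<sqinter> y \<le> z \<longleftrightarrow> x \<le> y \<cdot> z\<close>, which gives distributivity. Conversely \<open>x \<cdot> y = x' \<squnion> y\<close>.
  The axioms for \<open>\<nabla>\<close> are those for \<open>\<exists>\<close> rewritten in this way, and since all operations are
  terms in the operations of the other signature, both kinds of algebras have the same
  homomorphisms, so that the functors act as the identity on the underlying maps.\<close>

section \<open>Isomorphisms between categories of structures\<close>

text \<open>These are the laws that depend on the choice of \<open>Hom\<close>; the remaining
  category laws are general facts about \<open>compose\<close> and extensional maps.\<close>

locale hom_system =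
  fixes Ob :: "('a, 'b) partial_object_scheme set"
    and Hom :: "('a, 'b) partial_object_scheme \<Rightarrow> ('a, 'b) partial_object_scheme \<Rightarrow> ('a \<Rightarrow> 'a) set"
  assumes Hom_funcset: "\<lbrakk>A \<in> Ob; B \<in> Ob; f \<in> Hom A B\<rbrakk> \<Longrightarrow> f \<in> carrier A \<rightarrow> carrier B"
    and Hom_id: "A \<in> Ob \<Longrightarrow> (\<lambda>x \<in> carrier A. x) \<in> Hom A A"
    and Hom_compose: "\<lbrakk>A \<in> Ob; B \<in> Ob; C \<in> Ob; f \<in> Hom A B; g \<in> Hom B C\<rbrakk>
      \<Longrightarrow> compose (carrier A) g f \<in> Hom A C"
begin

lemma category_structure_category: "category (structure_category Ob Hom)"
proof unfold_locales
  fix f g h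
  assume "f \<in> Arr (structure_category Ob Hom)" "g \<in> Arr (structure_category Ob Hom)"
    "h \<in> Arr (structure_category Ob Hom)"
    "Cod (structure_category Ob Hom) f = Dom (structure_category Ob Hom) g"
    "Cod (structure_category Ob Hom) g = Dom (structure_category Ob Hom) h"
  then obtain A B C D f' g' h' where "f = (A, f', B)" "g = (B, g', C)" "h = (C, h', D)"
      "A \<in> Ob" "B \<in> Ob" "f' \<in> Hom A B"
    by (auto simp: structure_category_def)
  \<comment> \<open>\<open>compose (carrier B) h' g'\<close> is \<open>undefined\<close> off
    \<open>carrier B\<close>, so associativity relies on \<open>f'\<close> landing there.\<close>
  then show "Comp (structure_category Ob Hom) h (Comp (structure_category Ob Hom) g f) =
      Comp (structure_category Ob Hom) (Comp (structure_category Ob Hom) h g) f"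
    using compose_assoc[OF Hom_funcset[of A B f']] by (simp add: structure_category_def)
next
  fix f
  assume "f \<in> Arr (structure_category Ob Hom)"
  then obtain A h B where f: "f = (A, h, B)" "A \<in> Ob" "B \<in> Ob" "h \<in> Hom A B"
      "h \<in> extensional (carrier A)"
    by (auto simp: structure_category_def)
  have h: "h \<in> carrier A \<rightarrow> carrier B"
    using f Hom_funcset by blast
  show "Comp (structure_category Ob Hom) f
      (Id (structure_category Ob Hom) (Dom (structure_category Ob Hom) f)) = f"
    using f h by (auto simp: structure_category_def compose_def intro: extensionalityI)
  show "Comp (structure_category Ob Hom)
      (Id (structure_category Ob Hom) (Cod (structure_category Ob Hom) f)) f = f"
    using f h by (simp add: structure_category_def Id_compose)
qed (auto simp: structure_category_def intro: Hom_id Hom_compose)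

end

text \<open>Both functors keep the map in a triple and change only source and target. This works
  because composition and identities in \<open>structure_category\<close> depend only on carriers,
  which \<open>F\<close> preserves, and because the hom-sets agree as sets of functions.\<close>

lemma isomorphic_structure_categories:
  fixes Ob1 :: "('a, 'b) partial_object_scheme set"
    and Ob2 :: "('a, 'c) partial_object_scheme set"
  assumes H: "hom_system Ob1 Hom1"
    and F: "\<And>A. A \<in> Ob1 \<Longrightarrow> F A \<in> Ob2" "\<And>A. A \<in> Ob1 \<Longrightarrow> carrier (F A) = carrier A"
    and G: "\<And>B. B \<in> Ob2 \<Longrightarrow> G B \<in> Ob1"
    and GF: "\<And>A. A \<in> Ob1 \<Longrightarrow> G (F A) = A" and FG: "\<And>B. B \<in> Ob2 \<Longrightarrow> F (G B) = B"
    and Hom: "\<And>A B. \<lbrakk>A \<in> Ob1; B \<in> Ob1\<rbrakk> \<Longrightarrow> Hom2 (F A) (F B) = Hom1 A B"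
  shows "isomorphic_categories (structure_category Ob1 Hom1) (structure_category Ob2 Hom2)"
proof -
  interpret H1: hom_system Ob1 Hom1 by (rule H)
  have carrier_G: "carrier (G B) = carrier B" if "B \<in> Ob2" for B
    using F(2)[OF G[OF that]] FG[OF that] by simp
  have Hom_G: "Hom1 (G A) (G B) = Hom2 A B" if "A \<in> Ob2" "B \<in> Ob2" for A B
    using Hom[OF G G] that by (simp add: FG)
  \<comment> \<open>Every \<open>B\<close> in \<open>Ob2\<close> equals \<open>F (G B)\<close>, so
    the laws for \<open>Hom2\<close> are those for \<open>Hom1\<close> read along
    \<open>G\<close>.\<close>
  interpret H2: hom_system Ob2 Hom2
  proof
    fix A B f assume "A \<in> Ob2" "B \<in> Ob2" "f \<in> Hom2 A B"
    then show "f \<in> carrier A \<rightarrow> carrier B"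
      using H1.Hom_funcset[of "G A" "G B" f] by (simp add: G Hom_G carrier_G)
  next
    fix A assume "A \<in> Ob2"
    then show "(\<lambda>x \<in> carrier A. x) \<in> Hom2 A A"
      using H1.Hom_id[of "G A"] by (simp add: G Hom_G carrier_G)
  next
    fix A B C f g assume "A \<in> Ob2" "B \<in> Ob2" "C \<in> Ob2" "f \<in> Hom2 A B" "g \<in> Hom2 B C"
    then show "compose (carrier A) g f \<in> Hom2 A C"
      using H1.Hom_compose[of "G A" "G B" "G C" f g] by (simp add: G Hom_G carrier_G)
  qed
  let ?C = "structure_category Ob1 Hom1" and ?D = "structure_category Ob2 Hom2"
  interpret C: category ?C by (rule H1.category_structure_category)
  interpret D: category ?D by (rule H2.category_structure_category)
  let ?F = "\<lparr>on_obj = F, on_arr = (\<lambda>(A, h, B). (F A, h, F B))\<rparr>"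
  let ?G = "\<lparr>on_obj = G, on_arr = (\<lambda>(A, h, B). (G A, h, G B))\<rparr>"
  have "category_functor ?C ?D ?F"
    by unfold_locales (auto simp: structure_category_def F Hom)
  moreover have "category_functor ?D ?C ?G"
    by unfold_locales (auto simp: structure_category_def G carrier_G Hom_G)
  moreover have "\<forall>X \<in> Obj ?C. on_obj ?G (on_obj ?F X) = X"
    "\<forall>f \<in> Arr ?C. on_arr ?G (on_arr ?F f) = f"
    "\<forall>Y \<in> Obj ?D. on_obj ?F (on_obj ?G Y) = Y"
    "\<forall>g \<in> Arr ?D. on_arr ?F (on_arr ?G g) = g"
    by (auto simp: structure_category_def GF FG)
  ultimately show ?thesis
    using C.category_axioms D.category_axioms unfolding isomorphic_categories_def by blast
qed


section \<open>Bounded implication algebras are Boolean algebras\<close>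

context imp_algebra
begin

text \<open>The element \<open>x\<close> itself shows that the carrier is nonempty, so that the
  definite description in \<open>c1\<close> denotes.\<close>

lemma imp_self: "x \<in> carrier A \<Longrightarrow> x \<cdot> x = c\<^sub>1"
  unfolding c1_def by (rule theI2[where a = "x \<cdot> x"]) (auto intro: imp_self_eq)

end

context bounded_imp_algebra
begin

definition neg :: "'a \<Rightarrow> 'a" where
  "neg x = x \<cdot> c\<^sub>0"

definition sup :: "'a \<Rightarrow> 'a \<Rightarrow> 'a" where
  "sup x y = (x \<cdot> y) \<cdot> y"

definition inf :: "'a \<Rightarrow> 'a \<Rightarrow> 'a" where
  "inf x y = neg (x \<cdot> neg y)"

definition le :: "'a \<Rightarrow> 'a \<Rightarrow> bool" where
  "le x y \<longleftrightarrow> x \<cdot> y = c\<^sub>1"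

lemma c1_closed: "c\<^sub>1 \<in> carrier A"
  using imp_closed[OF c0_closed c0_closed] by (simp add: imp_self c0_closed)

lemma neg_closed: "x \<in> carrier A \<Longrightarrow> neg x \<in> carrier A"
  by (simp add: neg_def imp_closed c0_closed)

lemma sup_closed: "\<lbrakk>x \<in> carrier A; y \<in> carrier A\<rbrakk> \<Longrightarrow> sup x y \<in> carrier A"
  by (simp add: sup_def imp_closed)

lemma inf_closed: "\<lbrakk>x \<in> carrier A; y \<in> carrier A\<rbrakk> \<Longrightarrow> inf x y \<in> carrier A"
  by (simp add: inf_def imp_closed neg_closed)

lemmas closed = imp_closed c0_closed c1_closed neg_closed sup_closed inf_closed

section \<open>Order and joins from implication\<close>

lemma c1_imp: "x \<in> carrier A \<Longrightarrow> c\<^sub>1 \<cdot> x = x"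
  using imp_contract[of x x] by (simp add: imp_self)

lemma imp_c1: "x \<in> carrier A \<Longrightarrow> x \<cdot> c\<^sub>1 = c\<^sub>1"
  using imp_contract[of "c\<^sub>1" x] by (simp add: c1_imp c1_closed)

lemma le_refl: "x \<in> carrier A \<Longrightarrow> le x x"
  by (simp add: le_def imp_self)

text \<open>When both implications are \<open>c\<^sub>1\<close>, quasi-commutativity reads
  \<open>c\<^sub>1 \<cdot> y = c\<^sub>1 \<cdot> x\<close>.\<close>

lemma le_antisym: "\<lbrakk>x \<in> carrier A; y \<in> carrier A; le x y; le y x\<rbrakk> \<Longrightarrow> x = y"
  using imp_quasi_comm[of x y] by (simp add: le_def c1_imp)

lemma sup_comm: "\<lbrakk>x \<in> carrier A; y \<in> carrier A\<rbrakk> \<Longrightarrow> sup x y = sup y x"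
  by (simp add: sup_def imp_quasi_comm)

lemma sup_absorb: "\<lbrakk>y \<in> carrier A; le x y\<rbrakk> \<Longrightarrow> sup x y = y"
  by (simp add: sup_def le_def c1_imp)

lemma le_imp: "\<lbrakk>x \<in> carrier A; y \<in> carrier A\<rbrakk> \<Longrightarrow> le y (x \<cdot> y)"
  using imp_exchange[of y x y] by (simp add: le_def imp_self imp_c1)

lemma imp_le_swap: "\<lbrakk>x \<in> carrier A; y \<in> carrier A; z \<in> carrier A\<rbrakk>
    \<Longrightarrow> le x (y \<cdot> z) \<longleftrightarrow> le y (x \<cdot> z)"
  by (simp add: le_def imp_exchange[of x y z])

lemma le_trans:
  assumes "x \<in> carrier A" "y \<in> carrier A" "z \<in> carrier A" "le x y" "le y z"
  shows "le x z"
proof -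
  \<comment> \<open>Since \<open>y\<close> lies below \<open>z\<close>, \<open>z\<close> is the join
    of the two; in this form exchange can move \<open>x\<close> inwards, against
    \<open>y\<close>.\<close>
  have "z = (z \<cdot> y) \<cdot> y"
    using assms sup_absorb[of z y] sup_comm[of y z] by (simp add: sup_def)
  then have "x \<cdot> z = (z \<cdot> y) \<cdot> (x \<cdot> y)"
    using assms imp_exchange[of x "z \<cdot> y" y] by (simp add: closed)
  then show ?thesis
    using assms by (simp add: le_def imp_c1 closed)
qed

lemma sup_upper2: "\<lbrakk>x \<in> carrier A; y \<in> carrier A\<rbrakk> \<Longrightarrow> le y (sup x y)"
  by (simp add: sup_def le_imp closed)

lemma sup_upper1: "\<lbrakk>x \<in> carrier A; y \<in> carrier A\<rbrakk> \<Longrightarrow> le x (sup x y)"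
  using sup_upper2[of y x] by (simp add: sup_comm[of x y])

text \<open>As \<open>x\<close> lies below \<open>sup y z\<close>, which is
  \<open>(y \<cdot> z) \<cdot> z\<close>, exchange puts \<open>y \<cdot> z\<close> below
  \<open>x \<cdot> z\<close>.\<close>

lemma imp_antimono:
  assumes "x \<in> carrier A" "y \<in> carrier A" "z \<in> carrier A" "le x y"
  shows "le (y \<cdot> z) (x \<cdot> z)"
proof -
  have "le x (sup y z)"
    using assms le_trans[of x y "sup y z"] by (simp add: sup_upper1 closed)
  then show ?thesis
    using assms by (simp add: sup_def imp_le_swap[of x] closed)
qed

lemma imp_mono:
  assumes "x \<in> carrier A" "y \<in> carrier A" "z \<in> carrier A" "le y z"
  shows "le (x \<cdot> y) (x \<cdot> z)"
proof -
  have "z = (z \<cdot> y) \<cdot> y"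
    using assms sup_absorb[of z y] sup_comm[of y z] by (simp add: sup_def)
  then have "x \<cdot> z = (z \<cdot> y) \<cdot> (x \<cdot> y)"
    using assms imp_exchange[of x "z \<cdot> y" y] by (simp add: closed)
  then show ?thesis
    using assms by (simp add: le_imp closed)
qed

text \<open>Joining with \<open>y\<close> is an antitone operation applied twice, hence monotone,
  and \<open>sup z y\<close> is \<open>z\<close>.\<close>

lemma sup_least:
  assumes "x \<in> carrier A" "y \<in> carrier A" "z \<in> carrier A" "le x z" "le y z"
  shows "le (sup x y) z"
proof -
  have "le ((x \<cdot> y) \<cdot> y) ((z \<cdot> y) \<cdot> y)"
    using assms by (intro imp_antimono closed)
  also have "(z \<cdot> y) \<cdot> y = z"
    using assms sup_absorb[of z y] sup_comm[of y z] by (simp add: sup_def)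
  finally show ?thesis
    by (simp add: sup_def)
qed

lemma sup_le_iff:
  assumes "x \<in> carrier A" "y \<in> carrier A" "z \<in> carrier A"
  shows "le (sup x y) z \<longleftrightarrow> le x z \<and> le y z"
  using assms le_trans[of x "sup x y" z] le_trans[of y "sup x y" z]
  by (auto intro: sup_least sup_upper1 sup_upper2 closed)

section \<open>The complement\<close>

lemma c0_le: "x \<in> carrier A \<Longrightarrow> le c\<^sub>0 x"
  by (simp add: le_def c0_imp)

text \<open>Double negation is \<open>sup x c\<^sub>0\<close>; the commuted join collapses to
  \<open>x\<close> because \<open>c\<^sub>0 \<cdot> x = c\<^sub>1\<close>.\<close>

lemma neg_neg: "x \<in> carrier A \<Longrightarrow> neg (neg x) = x"
  using sup_comm[of x "c\<^sub>0"] by (simp add: neg_def sup_def c0_imp c1_imp c0_closed)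

text \<open>With \<open>y\<close> written as \<open>neg y \<cdot> c\<^sub>0\<close>, exchange swaps
  the premises \<open>x\<close> and \<open>neg y\<close>.\<close>

lemma imp_contrapos: "\<lbrakk>x \<in> carrier A; y \<in> carrier A\<rbrakk> \<Longrightarrow> neg y \<cdot> neg x = x \<cdot> y"
  using imp_exchange[of x "neg y" "c\<^sub>0"] neg_neg[of y] by (simp add: neg_def closed)

lemma neg_le_neg_iff: "\<lbrakk>x \<in> carrier A; y \<in> carrier A\<rbrakk> \<Longrightarrow> le (neg y) (neg x) \<longleftrightarrow> le x y"
  by (simp add: le_def imp_contrapos)

lemma neg_c1: "neg c\<^sub>1 = c\<^sub>0"
  by (simp add: neg_def c1_imp c0_closed)

text \<open>Recovering the implication from join and complement serves both the round trip on
  implication algebras and the proof that Boolean homomorphisms preserve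
  \<open>\<cdot>\<close>.\<close>

lemma sup_neg:
  assumes x: "x \<in> carrier A" and y: "y \<in> carrier A"
  shows "sup (neg x) y = x \<cdot> y"
proof (rule le_antisym)
  have "le (neg x) (x \<cdot> y)"
    unfolding neg_def using x y by (intro imp_mono c0_le closed)
  then show "le (sup (neg x) y) (x \<cdot> y)"
    using x y by (simp add: sup_le_iff le_imp closed)
  let ?u = "sup (neg x) y"
  have u: "?u \<in> carrier A"
    using x y by (intro closed)
  \<comment> \<open>An argument by contradiction: \<open>neg ?u\<close> gives \<open>x\<close>, so
    \<open>x \<cdot> ?u\<close> lies below \<open>neg ?u \<cdot> ?u\<close>, which contraction
    collapses to \<open>?u\<close>.\<close>
  have "le (neg ?u) (neg (neg x))"
    using x y u by (subst neg_le_neg_iff) (auto intro: sup_upper1 closed)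
  then have "le (neg ?u) x"
    using x by (simp add: neg_neg)
  then have "le (x \<cdot> ?u) (neg ?u \<cdot> ?u)"
    by (rule imp_antimono[OF neg_closed[OF u] x u])
  moreover have "neg ?u \<cdot> ?u = ?u"
    using imp_contract[OF u c0_closed] by (simp add: neg_def)
  moreover have "le (x \<cdot> y) (x \<cdot> ?u)"
    using x y u by (intro imp_mono sup_upper2 closed)
  ultimately show "le (x \<cdot> y) ?u"
    using le_trans[of "x \<cdot> y" "x \<cdot> ?u" ?u] x y u by (simp add: closed)
qed (use x y in \<open>auto intro: closed\<close>)

section \<open>Meets and residuation\<close>

lemma inf_eq: "\<lbrakk>x \<in> carrier A; y \<in> carrier A\<rbrakk> \<Longrightarrow> inf x y = neg (sup (neg x) (neg y))"
  by (simp add: inf_def sup_neg closed)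

lemma neg_inf: "\<lbrakk>x \<in> carrier A; y \<in> carrier A\<rbrakk> \<Longrightarrow> neg (inf x y) = sup (neg x) (neg y)"
  by (simp add: inf_eq neg_neg closed)

lemma inf_comm: "\<lbrakk>x \<in> carrier A; y \<in> carrier A\<rbrakk> \<Longrightarrow> inf x y = inf y x"
  by (simp add: inf_eq sup_comm[of "neg x" "neg y"] closed)

text \<open>Negating both sides turns this into \<open>sup_le_iff\<close>, since the complement
  reverses the order.\<close>

lemma le_inf_iff:
  assumes "x \<in> carrier A" "y \<in> carrier A" "z \<in> carrier A"
  shows "le z (inf x y) \<longleftrightarrow> le z x \<and> le z y"
  using assms neg_le_neg_iff[of z "inf x y"]
  by (simp add: neg_inf sup_le_iff neg_le_neg_iff closed)

text \<open>Contraposition moves the outer negation of \<open>inf y x\<close> over to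
  \<open>z\<close>, exchange swaps \<open>neg z\<close> with \<open>y\<close>, and contraposition
  turns \<open>neg z \<cdot> neg x\<close> into \<open>x \<cdot> z\<close>.\<close>

lemma inf_le_iff:
  assumes "x \<in> carrier A" "y \<in> carrier A" "z \<in> carrier A"
  shows "le (inf x y) z \<longleftrightarrow> le y (x \<cdot> z)"
proof -
  have "le (inf x y) z \<longleftrightarrow> le (neg z) (y \<cdot> neg x)"
    using assms neg_le_neg_iff[of "inf y x" z]
    by (simp add: inf_comm[of x y]) (simp add: inf_def neg_neg closed)
  also have "\<dots> \<longleftrightarrow> le y (neg z \<cdot> neg x)"
    using assms by (intro imp_le_swap closed)
  finally show ?thesis
    using assms by (simp add: imp_contrapos)
qed

text \<open>A Yoneda principle: with \<open>sup_le_iff\<close> and \<open>inf_le_iff\<close> it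
  reduces associativity and distributivity to propositional logic about upper bounds.\<close>

lemma le_eqI:
  assumes "x \<in> carrier A" "y \<in> carrier A" "\<And>z. z \<in> carrier A \<Longrightarrow> le x z \<longleftrightarrow> le y z"
  shows "x = y"
  using assms by (blast intro: le_antisym le_refl)

section \<open>The Boolean algebra laws\<close>

lemma sup_assoc: "\<lbrakk>x \<in> carrier A; y \<in> carrier A; z \<in> carrier A\<rbrakk>
    \<Longrightarrow> sup (sup x y) z = sup x (sup y z)"
  by (rule le_eqI) (auto simp: sup_le_iff closed)

lemma inf_assoc: "\<lbrakk>x \<in> carrier A; y \<in> carrier A; z \<in> carrier A\<rbrakk>
    \<Longrightarrow> inf (inf x y) z = inf x (inf y z)"
  by (simp add: inf_eq neg_neg sup_assoc closed)

lemma inf_absorb: "\<lbrakk>x \<in> carrier A; y \<in> carrier A; le x y\<rbrakk> \<Longrightarrow> inf x y = x"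
  by (simp add: inf_eq sup_comm[of "neg x" "neg y"] sup_absorb neg_le_neg_iff neg_neg closed)

lemma inf_sup_absorb: "\<lbrakk>x \<in> carrier A; y \<in> carrier A\<rbrakk> \<Longrightarrow> inf x (sup x y) = x"
  by (simp add: inf_absorb sup_upper1 closed)

lemma sup_inf_absorb:
  assumes "x \<in> carrier A" "y \<in> carrier A"
  shows "sup x (inf x y) = x"
proof -
  have "le (inf x y) x"
    using assms le_inf_iff[of x y "inf x y"] by (simp add: le_refl closed)
  then show ?thesis
    using assms by (simp add: sup_comm[of x "inf x y"] sup_absorb closed)
qed

text \<open>By residuation, meeting with \<open>x\<close> is left adjoint to implication from
  \<open>x\<close>, and left adjoints preserve joins.\<close>

lemma inf_sup_distrib: "\<lbrakk>x \<in> carrier A; y \<in> carrier A; z \<in> carrier A\<rbrakk>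
    \<Longrightarrow> inf x (sup y z) = sup (inf x y) (inf x z)"
  by (rule le_eqI) (auto simp: sup_le_iff inf_le_iff closed)

lemma sup_c0: "x \<in> carrier A \<Longrightarrow> sup x c\<^sub>0 = x"
  by (simp add: sup_comm[of x "c\<^sub>0"] sup_absorb c0_le closed)

lemma inf_c1: "x \<in> carrier A \<Longrightarrow> inf x c\<^sub>1 = x"
  by (simp add: inf_absorb le_def imp_c1 closed)

lemma inf_neg: "x \<in> carrier A \<Longrightarrow> inf x (neg x) = c\<^sub>0"
  by (simp add: inf_def neg_neg imp_self neg_c1)

lemma sup_neg_self: "x \<in> carrier A \<Longrightarrow> sup x (neg x) = c\<^sub>1"
  by (simp add: sup_comm[of x "neg x"] sup_neg imp_self closed)

end


section \<open>The implication of a Boolean algebra\<close>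

context bool_algebra
begin

lemmas bool_closed = meet_closed join_closed compl_closed zero_closed one_closed

section \<open>Complements and De Morgan's law\<close>

lemma meet_zero: "x \<in> carrier A \<Longrightarrow> x \<sqinter> \<zero> = \<zero>"
  using meet_join_absorb[of "\<zero>" x]
  by (simp add: join_comm[of "\<zero>" x] join_zero meet_comm[of x "\<zero>"] bool_closed)

lemma join_one: "x \<in> carrier A \<Longrightarrow> x \<squnion> \<one> = \<one>"
  using join_meet_absorb[of "\<one>" x]
  by (simp add: meet_comm[of "\<one>" x] meet_one join_comm[of x "\<one>"] bool_closed)

text \<open>One half of the uniqueness of complements; \<open>compl_unique\<close> applies it twice
  with the roles of \<open>y\<close> and \<open>z\<close> exchanged. Expanding \<open>y\<close> as
  \<open>y \<sqinter> (x \<squnion> z)\<close> leaves only the part in \<open>z\<close>.\<close>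

lemma compl_le_unique:
  assumes x: "x \<in> carrier A" and y: "y \<in> carrier A" and z: "z \<in> carrier A"
    and meet: "x \<sqinter> y = \<zero>" and join: "x \<squnion> z = \<one>"
  shows "y \<sqinter> z = y"
proof -
  have "y = y \<sqinter> (x \<squnion> z)"
    using y by (simp add: join meet_one)
  also have "\<dots> = \<zero> \<squnion> (y \<sqinter> z)"
    using x y z meet by (simp add: meet_join_distrib meet_comm[of y x])
  also have "\<dots> = y \<sqinter> z"
    using y z by (simp add: join_comm[of "\<zero>" "y \<sqinter> z"] join_zero bool_closed)
  finally show ?thesis ..
qed

lemma compl_unique:
  assumes x: "x \<in> carrier A" and y: "y \<in> carrier A" and "x \<sqinter> y = \<zero>" "x \<squnion> y = \<one>"
  shows "compl A x = y"
  using assms compl_le_unique[of x y "compl A x"] compl_le_unique[of x "compl A x" y]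
  by (simp add: meet_compl join_compl meet_comm[of y "compl A x"] bool_closed)

lemma compl_compl: "x \<in> carrier A \<Longrightarrow> compl A (compl A x) = x"
  by (rule compl_unique)
    (simp_all add: meet_comm[of "compl A x" x] join_comm[of "compl A x" x] meet_compl join_compl
      bool_closed)

lemma compl_zero: "compl A \<zero> = \<one>"
  by (rule compl_unique) (simp_all add: meet_one join_one bool_closed)

text \<open>The dual of the distributive law among the axioms: expand the right-hand side with that
  law and absorb twice.\<close>

lemma join_meet_distrib:
  assumes x: "x \<in> carrier A" and y: "y \<in> carrier A" and z: "z \<in> carrier A"
  shows "x \<squnion> (y \<sqinter> z) = (x \<squnion> y) \<sqinter> (x \<squnion> z)"
proof -
  have "(x \<squnion> y) \<sqinter> (x \<squnion> z) = ((x \<squnion> y) \<sqinter> x) \<squnion> ((x \<squnion> y) \<sqinter> z)"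
    using x y z by (intro meet_join_distrib bool_closed)
  also have "(x \<squnion> y) \<sqinter> x = x"
    using x y by (simp add: meet_comm[of "x \<squnion> y" x] meet_join_absorb bool_closed)
  also have "(x \<squnion> y) \<sqinter> z = (x \<sqinter> z) \<squnion> (y \<sqinter> z)"
    using x y z by (simp add: meet_comm[of "x \<squnion> y" z] meet_comm[of x z] meet_comm[of y z] meet_join_distrib
        bool_closed)
  also have "x \<squnion> ((x \<sqinter> z) \<squnion> (y \<sqinter> z)) = x \<squnion> (y \<sqinter> z)"
    using x y z by (simp add: join_assoc[symmetric] join_meet_absorb bool_closed)
  finally show ?thesis ..
qed

text \<open>Uniqueness of complements leaves one meet and one join, each computed by one of the two
  distributive laws.\<close>

lemma compl_join:
  assumes x: "x \<in> carrier A" and y: "y \<in> carrier A"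
  shows "compl A (x \<squnion> y) = compl A x \<sqinter> compl A y"
proof (rule compl_unique)
  let ?x = "compl A x" and ?y = "compl A y"
  have zero_meet: "\<zero> \<sqinter> z = \<zero>" if "z \<in> carrier A" for z
    using that meet_comm[of "\<zero>" z] by (simp add: meet_zero zero_closed)
  have "(?x \<sqinter> ?y) \<sqinter> x = \<zero>"
    using x y meet_assoc[of x ?x ?y] meet_comm[of "?x \<sqinter> ?y" x]
    by (simp add: meet_compl zero_meet bool_closed)
  moreover have "(?x \<sqinter> ?y) \<sqinter> y = \<zero>"
    using x y meet_assoc[of ?x ?y y] meet_comm[of ?y y]
    by (simp add: meet_compl meet_zero bool_closed)
  ultimately show "(x \<squnion> y) \<sqinter> (?x \<sqinter> ?y) = \<zero>"
    using x y meet_join_distrib[of "?x \<sqinter> ?y" x y] meet_comm[of "x \<squnion> y" "?x \<sqinter> ?y"]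
    by (simp add: join_zero bool_closed)
  have "(x \<squnion> y) \<squnion> ?x = \<one>"
    using x y join_assoc[of y x ?x] join_comm[of x y]
    by (simp add: join_compl join_one bool_closed)
  moreover have "(x \<squnion> y) \<squnion> ?y = \<one>"
    using x y by (simp add: join_assoc join_compl join_one bool_closed)
  ultimately show "(x \<squnion> y) \<squnion> (?x \<sqinter> ?y) = \<one>"
    using x y by (simp add: join_meet_distrib meet_one bool_closed)
qed (use x y in \<open>auto intro: bool_closed\<close>)

section \<open>Material implication\<close>

definition arrow :: "'a \<Rightarrow> 'a \<Rightarrow> 'a" where
  "arrow x y = compl A x \<squnion> y"

lemma arrow_closed: "\<lbrakk>x \<in> carrier A; y \<in> carrier A\<rbrakk> \<Longrightarrow> arrow x y \<in> carrier A"
  by (simp add: arrow_def bool_closed)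

lemma compl_arrow: "\<lbrakk>x \<in> carrier A; y \<in> carrier A\<rbrakk> \<Longrightarrow> compl A (arrow x y) = x \<sqinter> compl A y"
  by (simp add: arrow_def compl_join compl_compl bool_closed)

lemma arrow_arrow_left:
  assumes "x \<in> carrier A" "y \<in> carrier A"
  shows "arrow (arrow x y) x = x"
  using assms join_meet_absorb[of x "compl A y"]
    join_comm[of "x \<sqinter> compl A y" x]
  by (simp add: arrow_def[of "arrow x y"] compl_arrow bool_closed)

text \<open>The value is symmetric in \<open>x\<close> and \<open>y\<close>, which is what
  quasi-commutativity asks for; the equation also recovers the join in the round trip.\<close>

lemma arrow_arrow_right:
  assumes "x \<in> carrier A" "y \<in> carrier A"
  shows "arrow (arrow x y) y = x \<squnion> y"
proof -
  have "arrow (arrow x y) y = y \<squnion> (x \<sqinter> compl A y)"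
    using assms join_comm[of "x \<sqinter> compl A y" y]
    by (simp add: arrow_def[of "arrow x y"] compl_arrow bool_closed)
  then show ?thesis
    using assms by (simp add: join_meet_distrib join_compl meet_one join_comm[of x y] bool_closed)
qed

lemma arrow_exchange:
  assumes "x \<in> carrier A" "y \<in> carrier A" "z \<in> carrier A"
  shows "arrow x (arrow y z) = arrow y (arrow x z)"
  using assms by (simp add: arrow_def join_assoc[symmetric]
      join_comm[of "compl A x" "compl A y"] bool_closed)

lemma arrow_self: "x \<in> carrier A \<Longrightarrow> arrow x x = \<one>"
  by (simp add: arrow_def join_comm[of "compl A x" x] join_compl bool_closed)

lemma arrow_zero: "x \<in> carrier A \<Longrightarrow> arrow x \<zero> = compl A x"
  by (simp add: arrow_def join_zero bool_closed)

lemma zero_arrow: "x \<in> carrier A \<Longrightarrow> arrow \<zero> x = \<one>"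
  by (simp add: arrow_def compl_zero join_comm[of "\<one>" x] join_one bool_closed)

text \<open>This recovers the meet in the round trip, and it turns the axiom
  \<open>nabla_imp\<close> into \<open>ex_meet_ex\<close>.\<close>

lemma compl_arrow_compl: "\<lbrakk>x \<in> carrier A; y \<in> carrier A\<rbrakk> \<Longrightarrow> compl A (arrow x (compl A y)) = x \<sqinter> y"
  by (simp add: compl_arrow compl_compl bool_closed)

end


section \<open>The two functors\<close>

text \<open>The conditionals make the new operations \<open>undefined\<close> off the carrier, as
  objects of \<open>MBA\<close> require; \<open>nabla A\<close> is copied because it is already
  extensional when \<open>A\<close> is an object of \<open>MIA\<close>.\<close>

definition mba_of_mia :: "'a monadic_imp_algebra \<Rightarrow> 'a monadic_bool_algebra" where
  "mba_of_mia A = \<lparr>carrier = carrier A,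
    meet = (\<lambda>x y. if x \<in> carrier A \<and> y \<in> carrier A
      then (x \<cdot>\<^bsub>A\<^esub> (y \<cdot>\<^bsub>A\<^esub> c\<^sub>0\<^bsub>A\<^esub>)) \<cdot>\<^bsub>A\<^esub> c\<^sub>0\<^bsub>A\<^esub> else undefined),
    join = (\<lambda>x y. if x \<in> carrier A \<and> y \<in> carrier A then (x \<cdot>\<^bsub>A\<^esub> y) \<cdot>\<^bsub>A\<^esub> y else undefined),
    compl = (\<lambda>x \<in> carrier A. x \<cdot>\<^bsub>A\<^esub> c\<^sub>0\<^bsub>A\<^esub>),
    zero = c\<^sub>0\<^bsub>A\<^esub>, one = c\<^sub>1\<^bsub>A\<^esub>, ex = nabla A\<rparr>"

definition mia_of_mba :: "'a monadic_bool_algebra \<Rightarrow> 'a monadic_imp_algebra" where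
  "mia_of_mba B = \<lparr>carrier = carrier B,
    imp = (\<lambda>x y. if x \<in> carrier B \<and> y \<in> carrier B then compl B x \<squnion>\<^bsub>B\<^esub> y else undefined),
    c0 = \<zero>\<^bsub>B\<^esub>, nabla = ex B\<rparr>"

lemma carrier_mba_of_mia: "carrier (mba_of_mia A) = carrier A"
  by (simp add: mba_of_mia_def)

lemma monadic_bool_algebra_mba_of_mia:
  assumes "monadic_imp_algebra A"
  shows "monadic_bool_algebra (mba_of_mia A)"
proof -
  interpret monadic_imp_algebra A by fact
  have [simp]: "carrier (mba_of_mia A) = carrier A" "one (mba_of_mia A) = c1 A"
      "zero (mba_of_mia A) = c0 A" "ex (mba_of_mia A) = nabla A"
    by (simp_all add: mba_of_mia_def)
  have [simp]: "x \<in> carrier A \<Longrightarrow> compl (mba_of_mia A) x = neg x" for x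
    by (simp add: mba_of_mia_def neg_def)
  have [simp]: "\<lbrakk>x \<in> carrier A; y \<in> carrier A\<rbrakk> \<Longrightarrow> meet (mba_of_mia A) x y = inf x y"
      "\<lbrakk>x \<in> carrier A; y \<in> carrier A\<rbrakk> \<Longrightarrow> join (mba_of_mia A) x y = sup x y" for x y
    by (simp_all add: mba_of_mia_def inf_def sup_def neg_def)
  have "inf x (nabla A x) = x" if "x \<in> carrier A" for x
    using that imp_nabla[of x] by (simp add: inf_absorb le_def nabla_closed)
  moreover have "nabla A (inf x (nabla A y)) = inf (nabla A x) (nabla A y)"
    if "x \<in> carrier A" "y \<in> carrier A" for x y
    using nabla_imp[OF that] by (simp add: inf_def neg_def)
  ultimately show ?thesis
    by (unfold_locales, simp_all add: closed nabla_closed nabla_c0 bool_le_def inf_assoc sup_assoc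
        inf_sup_absorb sup_inf_absorb inf_sup_distrib sup_c0 inf_c1 inf_neg sup_neg_self)
      (simp_all add: inf_comm sup_comm)
qed

text \<open>The axioms of bounded and monadic implication algebras mention \<open>c1\<close>, so its
  value is needed before a record is known to satisfy them. The element \<open>a\<close> excludes
  the empty carrier, for which every \<open>c\<close> would fit the description.\<close>

lemma c1_eqI:
  assumes "a \<in> carrier A" "\<And>x. x \<in> carrier A \<Longrightarrow> x \<cdot>\<^bsub>A\<^esub> x = c"
  shows "c\<^sub>1\<^bsub>A\<^esub> = c"
  unfolding c1_def using assms by (intro the_equality) auto

lemma c1_mia_of_mba:
  assumes "bool_algebra B"
  shows "c1 (mia_of_mba B) = one B"
proof -
  interpret bool_algebra B by fact
  show ?thesis
    using zero_closed arrow_self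
    by (intro c1_eqI[of "zero B"]) (simp_all add: mia_of_mba_def arrow_def)
qed

lemma monadic_imp_algebra_mia_of_mba:
  assumes "monadic_bool_algebra B"
  shows "monadic_imp_algebra (mia_of_mba B)"
proof -
  interpret monadic_bool_algebra B by fact
  have [simp]: "carrier (mia_of_mba B) = carrier B" "c0 (mia_of_mba B) = zero B"
      "nabla (mia_of_mba B) = ex B"
    by (simp_all add: mia_of_mba_def)
  have [simp]: "c1 (mia_of_mba B) = one B"
    by (rule c1_mia_of_mba) (rule bool_algebra_axioms)
  have [simp]: "\<lbrakk>x \<in> carrier B; y \<in> carrier B\<rbrakk> \<Longrightarrow> imp (mia_of_mba B) x y = arrow x y" for x y
    by (simp add: mia_of_mba_def arrow_def)
  have "arrow x (ex B x) = \<one>\<^bsub>B\<^esub>" if x: "x \<in> carrier B" for x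
  proof -
    have "x \<squnion>\<^bsub>B\<^esub> ex B x = ex B x"
      using x le_ex[of x] join_meet_absorb[of "ex B x" x]
      by (simp add: bool_le_def meet_comm[of x "ex B x"] join_comm[of x "ex B x"] ex_closed)
    \<comment> \<open>Replace \<open>ex B x\<close> by its join with \<open>x\<close> and
      reassociate, so that \<open>compl B x\<close> meets its complement \<open>x\<close> and the
      join becomes \<open>\<one>\<close>.\<close>
    then show ?thesis
      using x join_assoc[of "compl B x" x "ex B x"] arrow_self[OF x] join_comm[of "\<one>\<^bsub>B\<^esub>" "ex B x"]
      by (simp add: arrow_def join_one ex_closed bool_closed)
  qed
  then show ?thesis
    by unfold_locales
      (simp_all add: arrow_closed bool_closed ex_closed arrow_arrow_left arrow_arrow_right
        join_comm arrow_exchange zero_arrow arrow_zero compl_arrow_compl ex_zero ex_meet_ex)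
qed

section \<open>The translations are mutually inverse\<close>

lemma mia_of_mba_of_mia:
  assumes "monadic_imp_algebra A" and ext: "case_prod (imp A) \<in> extensional (carrier A \<times> carrier A)"
  shows "mia_of_mba (mba_of_mia A) = A"
proof -
  interpret monadic_imp_algebra A by fact
  \<comment> \<open>On the carrier this is \<open>sup_neg\<close>; elsewhere both sides are
    \<open>undefined\<close>, the right one by \<open>ext\<close>.\<close>
  have "imp (mia_of_mba (mba_of_mia A)) x y = imp A x y" for x y
    using sup_neg[of x y] extensional_arb[OF ext, of "(x, y)"]
    by (auto simp: mia_of_mba_def mba_of_mia_def sup_def neg_def closed)
  then show ?thesis
    by (intro monadic_imp_algebra.equality) (auto simp: mia_of_mba_def mba_of_mia_def)
qed

lemma mba_of_mia_of_mba:
  assumes "monadic_bool_algebra B"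
    and ext: "case_prod (meet B) \<in> extensional (carrier B \<times> carrier B)"
      "case_prod (join B) \<in> extensional (carrier B \<times> carrier B)"
      "compl B \<in> extensional (carrier B)"
  shows "mba_of_mia (mia_of_mba B) = B"
proof -
  interpret monadic_bool_algebra B by fact
  have "meet (mba_of_mia (mia_of_mba B)) x y = meet B x y" for x y
    using compl_arrow_compl[of x y] extensional_arb[OF ext(1), of "(x, y)"]
    by (auto simp: mia_of_mba_def mba_of_mia_def arrow_def join_zero bool_closed)
  moreover have "join (mba_of_mia (mia_of_mba B)) x y = join B x y" for x y
    using arrow_arrow_right[of x y] extensional_arb[OF ext(2), of "(x, y)"]
    by (auto simp: mia_of_mba_def mba_of_mia_def arrow_def bool_closed)
  moreover have "compl (mba_of_mia (mia_of_mba B)) x = compl B x" for x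
    using extensional_arb[OF ext(3), of x]
    by (auto simp: mia_of_mba_def mba_of_mia_def join_zero bool_closed)
  \<comment> \<open>The unit comes back as \<open>c1\<close> of the intermediate algebra, a definite
    description that has to be evaluated.\<close>
  moreover have "one (mba_of_mia (mia_of_mba B)) = one B"
    by (simp add: mba_of_mia_def c1_mia_of_mba bool_algebra_axioms)
  ultimately show ?thesis
    by (intro monadic_bool_algebra.equality ext) (auto simp: mia_of_mba_def mba_of_mia_def)
qed

section \<open>Homomorphisms in the two signatures\<close>

lemma mba_hom_mba_of_mia:
  assumes "monadic_imp_algebra A" "monadic_imp_algebra B"
  shows "mba_hom (mba_of_mia A) (mba_of_mia B) = mia_hom A B"
proof (intro subset_antisym subsetI)
  interpret A: monadic_imp_algebra A by fact
  interpret B: monadic_imp_algebra B by fact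
  fix h
  {
    assume "h \<in> mba_hom (mba_of_mia A) (mba_of_mia B)"
    then have h: "h \<in> carrier A \<rightarrow> carrier B" "h (c0 A) = c0 B"
        "\<And>x. x \<in> carrier A \<Longrightarrow> h (nabla A x) = nabla B (h x)"
        "\<And>x. x \<in> carrier A \<Longrightarrow> h (A.neg x) = B.neg (h x)"
        "\<And>x y. \<lbrakk>x \<in> carrier A; y \<in> carrier A\<rbrakk> \<Longrightarrow> h (A.sup x y) = B.sup (h x) (h y)"
      by (auto simp: mba_hom_def bool_hom_def mba_of_mia_def A.sup_def B.sup_def A.neg_def B.neg_def
          Pi_iff)
    \<comment> \<open>Both implications are rewritten as \<open>sup (neg x) y\<close>, whose
      operations \<open>h\<close> preserves.\<close>
    have "h (x \<cdot>\<^bsub>A\<^esub> y) = h x \<cdot>\<^bsub>B\<^esub> h y" if "x \<in> carrier A" "y \<in> carrier A" for x y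
      using that h funcset_mem[OF h(1)]
      by (simp add: A.sup_neg[symmetric] B.sup_neg[symmetric] A.closed)
    with h show "h \<in> mia_hom A B"
      by (simp add: mia_hom_def)
  next
    assume "h \<in> mia_hom A B"
    then have h: "h \<in> carrier A \<rightarrow> carrier B" "h (c0 A) = c0 B"
        "\<And>x. x \<in> carrier A \<Longrightarrow> h (nabla A x) = nabla B (h x)"
        "\<And>x y. \<lbrakk>x \<in> carrier A; y \<in> carrier A\<rbrakk> \<Longrightarrow> h (x \<cdot>\<^bsub>A\<^esub> y) = h x \<cdot>\<^bsub>B\<^esub> h y"
      by (simp_all add: mia_hom_def)
    \<comment> \<open>\<open>c1\<close> is not an operation of the signature; it is preserved
      because it equals \<open>c\<^sub>0 \<cdot> c\<^sub>0\<close>.\<close>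
    have "h (c1 A) = c1 B"
      using h(2) h(4)[OF A.c0_closed A.c0_closed]
      by (simp add: A.imp_self B.imp_self A.closed B.closed)
    with h funcset_mem[OF h(1)] show "h \<in> mba_hom (mba_of_mia A) (mba_of_mia B)"
      by (simp add: mba_hom_def bool_hom_def mba_of_mia_def A.closed)
  }
qed

text \<open>The predicate \<open>P\<close> stands for the extensionality conditions on the objects
  of \<open>MIA\<close>; identities and composites are the same in every full subclass.\<close>

lemma mia_hom_system: "hom_system {A. monadic_imp_algebra A \<and> P A} mia_hom"
proof
  fix A assume "A \<in> {A. monadic_imp_algebra A \<and> P A}"
  then interpret monadic_imp_algebra A by simp
  show "(\<lambda>x \<in> carrier A. x) \<in> mia_hom A A"
    by (simp add: mia_hom_def closed nabla_closed)
next
  fix A B C f g assume "A \<in> {A. monadic_imp_algebra A \<and> P A}"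
    and f: "f \<in> mia_hom A B" and g: "g \<in> mia_hom B C"
  then interpret monadic_imp_algebra A by simp
  have "f x \<in> carrier B" if "x \<in> carrier A" for x
    using f that by (auto simp: mia_hom_def)
  with f g show "compose (carrier A) g f \<in> mia_hom A C"
    by (auto simp: mia_hom_def compose_def closed nabla_closed)
qed (simp add: mia_hom_def)

theorem theorem3p18:
  shows "isomorphic_categories
    (MIA :: ('a monadic_imp_algebra,
       'a monadic_imp_algebra \<times> ('a \<Rightarrow> 'a) \<times> 'a monadic_imp_algebra) category)
    (MBA :: ('a monadic_bool_algebra,
       'a monadic_bool_algebra \<times> ('a \<Rightarrow> 'a) \<times> 'a monadic_bool_algebra) category)"
  unfolding MIA_def MBA_def
proof (rule isomorphic_structure_categories[where F = mba_of_mia and G = mia_of_mba])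
  fix A :: "'a monadic_imp_algebra"
  assume "A \<in> {A. monadic_imp_algebra A \<and>
        case_prod (imp A) \<in> extensional (carrier A \<times> carrier A) \<and>
        nabla A \<in> extensional (carrier A)}"
  then show "mba_of_mia A \<in> {A. monadic_bool_algebra A \<and>
        case_prod (meet A) \<in> extensional (carrier A \<times> carrier A) \<and>
        case_prod (join A) \<in> extensional (carrier A \<times> carrier A) \<and>
        compl A \<in> extensional (carrier A) \<and>
        ex A \<in> extensional (carrier A)}"
    using monadic_bool_algebra_mba_of_mia[of A] by (auto simp: mba_of_mia_def extensional_def)
next
  fix B :: "'a monadic_bool_algebra"
  assume "B \<in> {A. monadic_bool_algebra A \<and>
        case_prod (meet A) \<in> extensional (carrier A \<times> carrier A) \<and>
        case_prod (join A) \<in> extensional (carrier A \<times> carrier A) \<and>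
        compl A \<in> extensional (carrier A) \<and>
        ex A \<in> extensional (carrier A)}"
  then show "mia_of_mba B \<in> {A. monadic_imp_algebra A \<and>
        case_prod (imp A) \<in> extensional (carrier A \<times> carrier A) \<and>
        nabla A \<in> extensional (carrier A)}"
    using monadic_imp_algebra_mia_of_mba[of B] by (auto simp: mia_of_mba_def extensional_def)
qed (auto simp: mia_hom_system mia_of_mba_of_mia mba_of_mia_of_mba mba_hom_mba_of_mia
    carrier_mba_of_mia)

end
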